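(* Let $n$ be a non-negative integer, $v$ a real number, and $x$ a complex variable. Then $$\sum_{k=0}^n(-1)^{n-k}\binom nk2^{-k}\binom{2k+v}{(2k+v)/2}\binom{k+v}{v/2}^{-1}(1-x)^{n-k}=\sum_{k=0}^{\lfloor n/2\rfloor}\binom n{2k}2^{-2k}\binom{2k}k\binom{(2k+v)/2}{k}^{-1}x^{n-2k}.$$
   Context: For non-negative integers the binomial coefficients are the usual ones (zero when the lower index exceeds the upper). Generalized binomial coefficients are defined for complex numbers $a,b$, excluding the set of negative integers, by $\binom ab=\frac{\Gamma(a+1)}{\Gamma(b+1)\Gamma(a-b+1)}$; the identity is read for those real $v$ for which the binomial coefficients in it are so defined. The notation $\binom ab^{-1}$ means the reciprocal $1/\binom ab$. The identity is one of polynomials in $x$, with $0^0=1$. *)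

theory Defs
  imports "HOL-Analysis.Analysis"
begin

definition negative_integers :: "complex set" where
  "negative_integers = \<int>\<^sub>\<le>\<^sub>0 - {0}"

(* Gamma is 0 at its poles and z / 0 = 0, so the value is 0 when a - b is a negative
   integer, in agreement with 1 / Gamma vanishing there. *)
definition gen_binomial :: "complex \<Rightarrow> complex \<Rightarrow> complex" where
  "gen_binomial a b = Gamma (a + 1) / (Gamma (b + 1) * Gamma (a - b + 1))"

definition gen_binomial_defined :: "complex \<Rightarrow> complex \<Rightarrow> bool" where
  "gen_binomial_defined a b \<longleftrightarrow> a \<notin> negative_integers \<and> b \<notin> negative_integers"

lemma gen_binomial_of_nat: "gen_binomial (of_nat n) (of_nat k) = of_nat (n choose k)"
proof (cases "k \<le> n")
  case True
  then have "(of_nat n - of_nat k + 1 :: complex) = 1 + of_nat (n - k)"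
    by (simp add: of_nat_diff)
  then have "Gamma (of_nat n - of_nat k + 1 :: complex) = fact (n - k)"
    by (simp only: Gamma_fact)
  moreover have "Gamma (of_nat m + 1 :: complex) = fact m" for m
    by (simp only: add.commute[of _ 1] Gamma_fact)
  ultimately show ?thesis
    using True by (simp only: gen_binomial_def binomial_fact)
next
  case False
  then have "(of_nat n - of_nat k + 1 :: complex) = - of_nat (k - n - 1)"
    by (simp add: of_nat_diff)
  then have "Gamma (of_nat n - of_nat k + 1 :: complex) = 0"
    by (simp add: Gamma_eq_zero_iff)
  then show ?thesis
    using False by (simp add: gen_binomial_def binomial_eq_0)
qed

end

theory Submission
  imports Defs "HOL-Computational_Algebra.Polynomial"
begin

text \<open>
  With \<open>a = (v + 1) / 2\<close>, the coefficients on the left are, by the duplication formula, the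
  numbers \<open>2 ^ k * pochhammer a k / pochhammer (2 * a) k\<close>, and the fractions are the moments of a
  Beta(a, a) variable \<open>B\<close>. So the left side is the expectation of \<open>(x + (2 * B - 1)) ^ n\<close>, and
  expanding in powers of \<open>x\<close> reduces the identity to the moments of the symmetric variable
  \<open>2 * B - 1\<close>. For general \<open>v\<close> there is no such distribution; the expectation is replaced by the
  linear functional on polynomials with the same moments, and the moments of \<open>2 * B - 1\<close> follow from
  an integration by parts formula, which is the recurrence of the moments of \<open>B\<close>.
\<close>

section \<open>The moment functional of the symmetric Beta distribution and its linearity\<close>

definition beta_functional :: "'a::field \<Rightarrow> 'a poly \<Rightarrow> 'a" where
  "beta_functional a p = (\<Sum>i\<le>degree p. coeff p i * (pochhammer a i / pochhammer (2 * a) i))"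

lemma beta_functional_altdef:
  assumes "degree p \<le> N"
  shows "beta_functional a p = (\<Sum>i\<le>N. coeff p i * (pochhammer a i / pochhammer (2 * a) i))"
  unfolding beta_functional_def
  by (rule sum.mono_neutral_left) (use assms in \<open>auto simp: coeff_eq_0\<close>)

lemma beta_functional_0 [simp]: "beta_functional a 0 = 0"
  by (simp add: beta_functional_def)

lemma beta_functional_add: "beta_functional a (p + q) = beta_functional a p + beta_functional a q"
proof -
  define N where "N = max (degree p) (degree q)"
  have "degree p \<le> N" "degree q \<le> N" "degree (p + q) \<le> N"
    by (auto simp: N_def degree_add_le)
  then show ?thesis
    by (simp add: beta_functional_altdef[where N = N] sum.distrib[symmetric] ring_distribs
        del: times_divide_eq_right)
qed

lemma beta_functional_smult: "beta_functional a (smult c p) = c * beta_functional a p"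
  using degree_smult_le[of c p]
  by (simp add: beta_functional_altdef[where N = "degree p"] sum_distrib_left mult.assoc)

lemma beta_functional_diff: "beta_functional a (p - q) = beta_functional a p - beta_functional a q"
  using beta_functional_add[of a "p - q" q] by simp

lemma beta_functional_sum: "beta_functional a (\<Sum>i\<in>A. f i) = (\<Sum>i\<in>A. beta_functional a (f i))"
  by (induction A rule: infinite_finite_induct) (auto simp: beta_functional_add)

lemma beta_functional_monom:
  "beta_functional a (monom c k) = c * (pochhammer a k / pochhammer (2 * a) k)"
proof -
  have "beta_functional a (monom c k)
      = (\<Sum>i\<le>k. coeff (monom c k) i * (pochhammer a i / pochhammer (2 * a) i))"
    by (intro beta_functional_altdef degree_monom_le)
  also have "\<dots> = c * (pochhammer a k / pochhammer (2 * a) k)"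
    by (subst sum.remove[of _ k]) auto
  finally show ?thesis .
qed

section \<open>Integration by parts and the moments about the centre\<close>

text \<open>For the density proportional to \<open>(t * (1 - t)) powr (a - 1)\<close> this is the
  vanishing integral of the derivative of \<open>(t * (1 - t)) powr a * p\<close>, up to sign. On
  \<open>t ^ k\<close> it is the moment recurrence
  \<open>(2 * a + k) * m (k + 1) = (a + k) * m k\<close>.\<close>

lemma beta_functional_by_parts:
  fixes a :: "'a::field"
  assumes "\<And>k. 2 * a + of_nat k \<noteq> 0"
  shows "beta_functional a (smult a [:-1, 2:] * p + [:0, -1, 1:] * pderiv p) = 0"
proof -
  have monom: "beta_functional a (smult a [:-1, 2:] * monom c k + [:0, -1, 1:] * pderiv (monom c k)) = 0"
    for c k
  proof -
    have "smult a [:-1, 2:] * monom c k + [:0, -1, 1:] * pderiv (monom c k)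
        = monom ((2 * a + of_nat k) * c) (Suc k) - monom ((a + of_nat k) * c) k"
      by (rule poly_eqI)
        (auto simp: coeff_pderiv coeff_pCons algebra_simps split: nat.split)
    then show ?thesis
      using assms[of k]
      by (simp add: beta_functional_diff beta_functional_monom pochhammer_Suc)
  qed
  show ?thesis
  \<comment> \<open>Both the multiplication and the derivation are additive in \<open>p\<close>, so
    monomials suffice.\<close>
  proof (subst (1 2) poly_as_sum_of_monoms[of p, symmetric])
    show "beta_functional a (smult a [:-1, 2:] * (\<Sum>i\<le>degree p. monom (coeff p i) i)
        + [:0, -1, 1:] * pderiv (\<Sum>i\<le>degree p. monom (coeff p i) i)) = 0"
      using monom
      by (simp only: higher_pderiv_sum[of 1, simplified] sum_distrib_left sum.distrib[symmetric]
          beta_functional_sum sum.neutral_const)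
  qed
qed

lemma beta_functional_centered_1:
  fixes a :: "'a::field"
  assumes "\<And>k. 2 * a + of_nat k \<noteq> 0"
  shows "beta_functional a [:-1, 2:] = 0"
proof -
  have "a \<noteq> 0"
    using assms[of 0] by auto
  then show ?thesis
    using beta_functional_by_parts[OF assms, where p = 1]
    by (simp only: pderiv_1 mult_zero_right add_0_right mult_1_right beta_functional_smult) simp
qed

text \<open>Integration by parts is applied to a power of \<open>u = 2 * t - 1\<close>; the
  recurrence closes because the derivative term is again a polynomial in \<open>u\<close>.\<close>

lemma beta_functional_centered_Suc_Suc:
  fixes a :: "'a::field_char_0"
  assumes "\<And>k. 2 * a + of_nat k \<noteq> 0"
  shows "(2 * a + of_nat (Suc n)) * beta_functional a ([:-1, 2:] ^ Suc (Suc n))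
       = of_nat (Suc n) * beta_functional a ([:-1, 2:] ^ n)"
proof -
  define u w :: "'a poly" where "u = [:-1, 2:]" and "w = [:0, -1, 1:]"
  \<comment> \<open>This is \<open>4 * t * (t - 1) = (2 * t - 1) ^ 2 - 1\<close>; doubling avoids
    halves.\<close>
  have X: "smult 2 (w * pderiv u) = u * u - 1"
    by (simp add: u_def w_def pderiv_pCons one_pCons)
  have "smult 2 (smult a u * u ^ Suc n + w * pderiv (u ^ Suc n))
      = smult (2 * a) (u ^ Suc (Suc n)) + smult (of_nat (Suc n)) (u ^ n * smult 2 (w * pderiv u))"
    unfolding pderiv_power_Suc by (simp add: smult_add_right mult_ac del: of_nat_Suc)
  also have "\<dots> = smult (2 * a + of_nat (Suc n)) (u ^ Suc (Suc n)) - smult (of_nat (Suc n)) (u ^ n)"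
    unfolding X by (simp add: algebra_simps smult_add_left smult_diff_right)
  finally have "beta_functional a (smult (2 * a + of_nat (Suc n)) (u ^ Suc (Suc n))
      - smult (of_nat (Suc n)) (u ^ n)) = 0"
    using beta_functional_by_parts[OF assms, where p = "u ^ Suc n"]
    by (metis beta_functional_smult mult_zero_right u_def w_def)
  then show ?thesis
    by (simp only: beta_functional_diff beta_functional_smult u_def) simp
qed

text \<open>The recurrence moves by two and starts from a vanishing first moment.\<close>

lemma beta_functional_centered_odd:
  fixes a :: "'a::field_char_0"
  assumes "\<And>k. 2 * a + of_nat k \<noteq> 0"
  shows "beta_functional a ([:-1, 2:] ^ Suc (2 * k)) = 0"
proof (induction k)
  case 0
  then show ?case
    using beta_functional_centered_1[OF assms] by simp
next
  case (Suc k)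
  have "(2 * a + of_nat (Suc (Suc (2 * k)))) * beta_functional a ([:-1, 2:] ^ Suc (2 * Suc k)) = 0"
    using beta_functional_centered_Suc_Suc[OF assms, of "Suc (2 * k)"] Suc by simp
  then show ?case
    using assms[of "Suc (Suc (2 * k))"] by (metis mult_eq_0_iff)
qed

text \<open>Starting from total mass 1, each step contributes the factor
  \<open>(2 * k + 1) / (2 * a + 2 * k + 1)\<close>; halving numerator and denominator gives the next
  Pochhammer factors.\<close>

lemma beta_functional_centered_even:
  fixes a :: "'a::field_char_0"
  assumes "\<And>k. 2 * a + of_nat k \<noteq> 0"
  shows "beta_functional a ([:-1, 2:] ^ (2 * k)) = pochhammer (1 / 2) k / pochhammer (a + 1 / 2) k"
proof (induction k)
  case 0
  then show ?case
    using beta_functional_monom[of a 1 0] by (simp add: one_pCons monom_0)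
next
  case (Suc k)
  define M where "M = beta_functional a ([:-1, 2:] ^ (2 * Suc k))"
  have nz: "2 * a + of_nat (Suc (2 * k)) \<noteq> 0"
    by (rule assms)
  have "(2 * a + of_nat (Suc (2 * k))) * M
      = of_nat (Suc (2 * k)) * (pochhammer (1 / 2) k / pochhammer (a + 1 / 2) k)"
    using beta_functional_centered_Suc_Suc[OF assms, of "2 * k"] Suc by (simp add: M_def)
  then have "M = of_nat (Suc (2 * k)) / (2 * a + of_nat (Suc (2 * k)))
      * (pochhammer (1 / 2) k / pochhammer (a + 1 / 2) k)"
    using nz by (metis nonzero_mult_div_cancel_left times_divide_eq_left)
  also have "of_nat (Suc (2 * k)) / (2 * a + of_nat (Suc (2 * k)))
      = (2 * (1 / 2 + of_nat k)) / (2 * (a + 1 / 2 + of_nat k))"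
    by (simp add: algebra_simps)
  also have "\<dots> = (1 / 2 + of_nat k) / (a + 1 / 2 + of_nat k)"
    by (rule mult_divide_mult_cancel_left) simp
  finally show ?case
    unfolding M_def[symmetric] by (simp add: pochhammer_Suc mult.commute)
qed

section \<open>Two binomial expansions under the functional\<close>

lemma beta_functional_binomial:
  "beta_functional a ([:y, z:] ^ n)
     = (\<Sum>k\<le>n. of_nat (n choose k) * z ^ k * (pochhammer a k / pochhammer (2 * a) k) * y ^ (n - k))"
proof -
  have "[:y, z:] ^ n = (monom z 1 + [:y:]) ^ n"
    by (simp add: monom_altdef)
  also have "\<dots> = (\<Sum>k\<le>n. of_nat (n choose k) * monom z 1 ^ k * [:y:] ^ (n - k))"
    by (rule binomial_ring)
  also have "\<dots> = (\<Sum>k\<le>n. monom (of_nat (n choose k) * z ^ k * y ^ (n - k)) k)"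
    by (intro sum.cong refl)
      (simp add: monom_power of_nat_poly poly_const_pow smult_monom mult_ac)
  finally show ?thesis
    by (simp add: beta_functional_sum beta_functional_monom mult_ac)
qed

text \<open>With \<open>y = -1\<close> and \<open>z = 2\<close> this expands the moment of
  \<open>x + (2 * t - 1)\<close> in powers of \<open>x\<close>, leaving the centred moments as
  coefficients.\<close>

lemma beta_functional_shift:
  "beta_functional a ([:x + y, z:] ^ n)
     = (\<Sum>j\<le>n. of_nat (n choose j) * beta_functional a ([:y, z:] ^ j) * x ^ (n - j))"
proof -
  have "[:x + y, z:] ^ n = ([:y, z:] + [:x:]) ^ n"
    by (simp add: add.commute)
  also have "\<dots> = (\<Sum>j\<le>n. of_nat (n choose j) * [:y, z:] ^ j * [:x:] ^ (n - j))"
    by (rule binomial_ring)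
  also have "\<dots> = (\<Sum>j\<le>n. smult (of_nat (n choose j) * x ^ (n - j)) ([:y, z:] ^ j))"
    by (intro sum.cong refl) (simp add: of_nat_poly poly_const_pow mult_ac)
  finally show ?thesis
    by (simp add: beta_functional_sum beta_functional_smult mult_ac)
qed

lemma sum_atMost_even:
  fixes f :: "nat \<Rightarrow> 'a::comm_monoid_add"
  assumes "\<And>k. f (Suc (2 * k)) = 0"
  shows "(\<Sum>j\<le>n. f j) = (\<Sum>k\<le>n div 2. f (2 * k))"
proof -
  have "(\<Sum>k\<le>n div 2. f (2 * k)) = sum f ((\<lambda>k. 2 * k) ` {..n div 2})"
    by (subst sum.reindex) (auto simp: inj_on_def)
  also have "\<dots> = sum f {..n}"
  proof (rule sum.mono_neutral_left)
    show "\<forall>j\<in>{..n} - (\<lambda>k. 2 * k) ` {..n div 2}. f j = 0"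
    proof
      fix j assume j: "j \<in> {..n} - (\<lambda>k. 2 * k) ` {..n div 2}"
      have "odd j"
      proof
        assume "even j"
        then have "j = 2 * (j div 2)" "j div 2 \<le> n div 2"
          using j by (auto intro: div_le_mono)
        then show False
          using j by blast
      qed
      then show "f j = 0"
        using assms by (auto elim!: oddE)
    qed
  qed auto
  finally show ?thesis
    by simp
qed

section \<open>Generalized binomial coefficients as Pochhammer quotients\<close>

lemma gen_binomial_ratio:
  fixes v :: complex
  assumes "v + 1 \<notin> \<int>\<^sub>\<le>\<^sub>0" and "v / 2 + 1 \<notin> \<int>\<^sub>\<le>\<^sub>0"
  shows "gen_binomial (2 * of_nat k + v) ((2 * of_nat k + v) / 2)
           * inverse (gen_binomial (of_nat k + v) (v / 2))
       = 4 ^ k * (pochhammer ((v + 1) / 2) k / pochhammer (v + 1) k)"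
proof -
  define h where "h = v / 2"
  have v: "v = 2 * h"
    by (simp add: h_def)
  have h1: "h + 1 \<notin> \<int>\<^sub>\<le>\<^sub>0" and v1: "2 * h + 1 \<notin> \<int>\<^sub>\<le>\<^sub>0"
    using assms by (simp_all add: v)
  have G: "Gamma (h + 1) \<noteq> 0" "Gamma (2 * h + 1) \<noteq> 0"
    using h1 v1 by (simp_all add: Gamma_eq_zero_iff)
  have p: "pochhammer (h + 1) k \<noteq> 0" "pochhammer (2 * h + 1) k \<noteq> 0"
    using h1 v1 by (auto simp: pochhammer_eq_0_iff)
  have g1: "Gamma (h + 1 + of_nat k) = pochhammer (h + 1) k * Gamma (h + 1)"
    and g2: "Gamma (2 * h + 1 + of_nat m) = pochhammer (2 * h + 1) m * Gamma (2 * h + 1)" for m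
    using G by (simp_all add: pochhammer_Gamma[OF h1] pochhammer_Gamma[OF v1])
  \<comment> \<open>Duplication splits the factors of the rising factorial into those of even and
    odd position.\<close>
  have "pochhammer (2 * h + 1) (2 * k)
      = 4 ^ k * pochhammer ((v + 1) / 2) k * pochhammer (h + 1) k"
    using pochhammer_double[of "h + 1 / 2" k] power_mult[of "2 :: complex" 2 k]
    by (simp add: v add_divide_distrib algebra_simps)
  moreover have "gen_binomial (2 * of_nat k + v) ((2 * of_nat k + v) / 2)
      = Gamma (2 * h + 1 + of_nat (2 * k)) / (Gamma (h + 1 + of_nat k) * Gamma (h + 1 + of_nat k))"
    by (simp add: gen_binomial_def v add_divide_distrib algebra_simps)
  ultimately have *: "gen_binomial (2 * of_nat k + v) ((2 * of_nat k + v) / 2)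
      = 4 ^ k * pochhammer ((v + 1) / 2) k * pochhammer (h + 1) k * Gamma (2 * h + 1)
        / ((pochhammer (h + 1) k * Gamma (h + 1)) * (pochhammer (h + 1) k * Gamma (h + 1)))"
    unfolding g1 g2 by simp
  have "gen_binomial (of_nat k + v) (v / 2)
      = Gamma (2 * h + 1 + of_nat k) / (Gamma (h + 1) * Gamma (h + 1 + of_nat k))"
    by (simp add: gen_binomial_def v algebra_simps)
  then have "gen_binomial (of_nat k + v) (v / 2)
      = pochhammer (v + 1) k * Gamma (2 * h + 1) / (Gamma (h + 1) * (pochhammer (h + 1) k * Gamma (h + 1)))"
    unfolding g1 g2 by (simp add: v)
  with * show ?thesis
    using G p by simp
qed

text \<open>The central binomial coefficient is
  \<open>4 ^ k * pochhammer (1 / 2) k / fact k\<close>, and its factorial cancels against that of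
  the generalized coefficient.\<close>

lemma inverse_gen_binomial_central:
  fixes h :: complex
  assumes "h + 1 \<notin> \<int>\<^sub>\<le>\<^sub>0"
  shows "of_nat ((2 * k) choose k) * inverse (gen_binomial (of_nat k + h) (of_nat k))
       = 4 ^ k * (pochhammer (1 / 2) k / pochhammer (h + 1) k)"
proof -
  have G: "Gamma (h + 1) \<noteq> 0"
    using assms by (simp add: Gamma_eq_zero_iff)
  have g: "Gamma (h + 1 + of_nat k) = pochhammer (h + 1) k * Gamma (h + 1)"
    using G by (simp add: pochhammer_Gamma[OF assms])
  have "gen_binomial (of_nat k + h) (of_nat k)
      = Gamma (h + 1 + of_nat k) / (fact k * Gamma (h + 1))"
    using Gamma_fact[of k, where 'a = complex] by (simp add: gen_binomial_def algebra_simps)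
  also have "\<dots> = pochhammer (h + 1) k / fact k"
    using G by (simp add: g)
  finally have b: "gen_binomial (of_nat k + h) (of_nat k) = pochhammer (h + 1) k / fact k" .
  have "of_nat ((2 * k) choose k) = (fact (2 * k) / (fact k * fact k) :: complex)"
    by (subst binomial_fact) (auto simp: mult_2)
  also have "\<dots> = 4 ^ k * pochhammer (1 / 2) k / fact k"
    by (simp add: fact_double power_mult)
  finally show ?thesis
    by (simp add: b)
qed

theorem theorem16:
  fixes n :: nat and v :: real and x :: complex
  assumes "\<And>k. k \<le> n \<Longrightarrow>
             gen_binomial_defined (2 * of_nat k + of_real v) ((2 * of_nat k + of_real v) / 2)"
    and "\<And>k. k \<le> n \<Longrightarrow>
             gen_binomial_defined (of_nat k + of_real v) (of_real v / 2)"
    and "\<And>k. k \<le> n div 2 \<Longrightarrow>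
             gen_binomial_defined ((2 * of_nat k + of_real v) / 2) (of_nat k)"
  shows "(\<Sum>k=0..n. (-1) ^ (n - k) * of_nat (n choose k) * 2 powi (- int k)
            * gen_binomial (2 * of_nat k + of_real v) ((2 * of_nat k + of_real v) / 2)
            * inverse (gen_binomial (of_nat k + of_real v) (of_real v / 2))
            * (1 - x) ^ (n - k))
       = (\<Sum>k=0..n div 2. of_nat (n choose (2 * k)) * 2 powi (- 2 * int k)
            * of_nat ((2 * k) choose k)
            * inverse (gen_binomial ((2 * of_nat k + of_real v) / 2) (of_nat k))
            * x ^ (n - 2 * k))"
proof -
  define a :: complex where "a = (of_real v + 1) / 2"
  \<comment> \<open>Not being a negative integer means that \<open>Gamma\<close> has no pole at
    \<open>z + 1\<close>.\<close>
  have shift: "z + 1 \<notin> \<int>\<^sub>\<le>\<^sub>0" if "z \<notin> negative_integers" for z :: complex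
  proof
    assume "z + 1 \<in> \<int>\<^sub>\<le>\<^sub>0"
    then obtain m where "z + 1 = - of_nat m"
      by (elim nonpos_Ints_cases')
    then have z: "z = - of_nat (Suc m)"
      by (simp add: eq_diff_eq[symmetric])
    have "z \<in> \<int>\<^sub>\<le>\<^sub>0" "z \<noteq> 0"
      unfolding z by (auto simp del: of_nat_Suc)
    with that show False
      by (simp add: negative_integers_def)
  qed
  \<comment> \<open>At \<open>k = 0\<close> the coefficient has upper index \<open>v\<close> and
    lower index \<open>v / 2\<close>.\<close>
  have v: "complex_of_real v + 1 \<notin> \<int>\<^sub>\<le>\<^sub>0" and h: "complex_of_real v / 2 + 1 \<notin> \<int>\<^sub>\<le>\<^sub>0"
    using assms(2)[of 0] by (auto simp: gen_binomial_defined_def intro!: shift)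
  have a2: "2 * a = of_real v + 1" "a + 1 / 2 = of_real v / 2 + 1"
    by (simp_all add: a_def field_simps)
  have a: "2 * a + of_nat k \<noteq> 0" for k
  proof
    assume "2 * a + of_nat k = 0"
    then have "complex_of_real v + 1 = - of_nat k"
      unfolding a2 eq_neg_iff_add_eq_0 .
    with v show False
      by simp
  qed
  have "(\<Sum>k=0..n. (-1) ^ (n - k) * of_nat (n choose k) * 2 powi (- int k)
            * gen_binomial (2 * of_nat k + of_real v) ((2 * of_nat k + of_real v) / 2)
            * inverse (gen_binomial (of_nat k + of_real v) (of_real v / 2))
            * (1 - x) ^ (n - k))
      = (\<Sum>k\<le>n. of_nat (n choose k) * 2 ^ k * (pochhammer a k / pochhammer (2 * a) k)
            * (x + -1) ^ (n - k))"
  proof (intro sum.cong)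
    fix k
    \<comment> \<open>The sign turns \<open>1 - x\<close> into \<open>x - 1\<close>, written
      \<open>x + -1\<close> to fit \<open>beta_functional_shift\<close>.\<close>
    have pow: "(x + -1) ^ (n - k) = (-1) ^ (n - k) * (1 - x) ^ (n - k)"
      by (simp add: power_mult_distrib[symmetric])
    have two: "2 powi (- int k) * 4 ^ k = (2 ^ k :: complex)"
      by (simp add: power_int_minus field_simps power_mult_distrib[symmetric])
    have "(-1) ^ (n - k) * of_nat (n choose k) * 2 powi (- int k)
            * gen_binomial (2 * of_nat k + of_real v) ((2 * of_nat k + of_real v) / 2)
            * inverse (gen_binomial (of_nat k + of_real v) (of_real v / 2)) * (1 - x) ^ (n - k)
        = of_nat (n choose k) * (2 powi (- int k)
            * (gen_binomial (2 * of_nat k + of_real v) ((2 * of_nat k + of_real v) / 2)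
            * inverse (gen_binomial (of_nat k + of_real v) (of_real v / 2))))
            * ((-1) ^ (n - k) * (1 - x) ^ (n - k))"
      by (simp only: mult_ac)
    also have "\<dots> = of_nat (n choose k) * (2 powi (- int k) * 4 ^ k
            * (pochhammer a k / pochhammer (2 * a) k)) * (x + -1) ^ (n - k)"
      by (simp only: gen_binomial_ratio[OF v h] a2 pow a_def[symmetric] mult.assoc)
    finally show "(-1) ^ (n - k) * of_nat (n choose k) * 2 powi (- int k)
            * gen_binomial (2 * of_nat k + of_real v) ((2 * of_nat k + of_real v) / 2)
            * inverse (gen_binomial (of_nat k + of_real v) (of_real v / 2)) * (1 - x) ^ (n - k)
        = of_nat (n choose k) * 2 ^ k * (pochhammer a k / pochhammer (2 * a) k)
            * (x + -1) ^ (n - k)"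
      by (simp only: two mult.assoc)
  qed auto
  also have "\<dots> = beta_functional a ([:x + -1, 2:] ^ n)"
    by (rule beta_functional_binomial[symmetric])
  also have "\<dots> = (\<Sum>j\<le>n. of_nat (n choose j) * beta_functional a ([:-1, 2:] ^ j) * x ^ (n - j))"
    by (rule beta_functional_shift)
  also have "\<dots> = (\<Sum>k\<le>n div 2. of_nat (n choose (2 * k))
      * beta_functional a ([:-1, 2:] ^ (2 * k)) * x ^ (n - 2 * k))"
    by (rule sum_atMost_even) (simp only: beta_functional_centered_odd[OF a] mult_zero_left mult_zero_right)
  also have "\<dots> = (\<Sum>k=0..n div 2. of_nat (n choose (2 * k)) * 2 powi (- 2 * int k)
            * of_nat ((2 * k) choose k)
            * inverse (gen_binomial ((2 * of_nat k + of_real v) / 2) (of_nat k))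
            * x ^ (n - 2 * k))"
  proof (intro sum.cong)
    fix k
    \<comment> \<open>Inserting this factor 1 supplies the \<open>4 ^ k\<close> needed to read
      \<open>inverse_gen_binomial_central\<close> backwards.\<close>
    have four: "2 powi (- 2 * int k) * 4 ^ k = (1 :: complex)"
      by (simp add: power_int_minus power_int_mult)
    have half: "(2 * of_nat k + complex_of_real v) / 2 = of_nat k + of_real v / 2"
      by (simp add: add_divide_distrib)
    have "beta_functional a ([:-1, 2:] ^ (2 * k))
        = 2 powi (- 2 * int k) * 4 ^ k * (pochhammer (1 / 2) k / pochhammer (a + 1 / 2) k)"
      by (simp only: beta_functional_centered_even[OF a] four mult_1_left)
    also have "\<dots> = 2 powi (- 2 * int k) * (of_nat ((2 * k) choose k)
            * inverse (gen_binomial ((2 * of_nat k + of_real v) / 2) (of_nat k)))"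
      by (simp only: half inverse_gen_binomial_central[OF h] a2 mult.assoc)
    finally show "of_nat (n choose (2 * k)) * beta_functional a ([:-1, 2:] ^ (2 * k)) * x ^ (n - 2 * k)
        = of_nat (n choose (2 * k)) * 2 powi (- 2 * int k) * of_nat ((2 * k) choose k)
            * inverse (gen_binomial ((2 * of_nat k + of_real v) / 2) (of_nat k)) * x ^ (n - 2 * k)"
      by (simp only: mult.assoc)
  qed auto
  finally show ?thesis .
qed

end
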